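(* Let $i,j,z \in \mathbb{N}$ and let $Y$ be any Young diagram with $z$ steps. Then: (i) if $z < \binom{i+j}{i}$, there exists an $(i,j)$-local partition of $Y$ into actual rectangles; (ii) if $z \geq \binom{i+j}{i}$, there exists no $(i,j)$-local cover of $Y$ with generalized rectangles.
   Context: For $x \in \mathbb{N}$ let $[x] = \{1,\ldots,x\}$. A Young diagram with $r$ rows and $c$ columns is a subset $Y \subseteq [r] \times [c]$ such that whenever $(i,j) \in Y$, then $(i-1,j) \in Y$ if $i \geq 2$ and $(i,j-1) \in Y$ if $j \geq 2$. The steps of $Y$ are the elements of $Z = \{(s,t) \in Y : (s+1,t) \notin Y \text{ and } (s,t+1) \notin Y\}$. A generalized rectangle in $Y$ is a set $R = S \times T$ with $S \subseteq [r]$, $T \subseteq [c]$ and $R \subseteq Y$; it uses the rows in $S$ and the columns in $T$. It is an actual rectangle if moreover $S$ is a set of consecutive integers and $T$ is a set of consecutive integers. A cover of $Y$ is a set $C$ of rectangles with $Y = \bigcup_{R \in C} R$; a partition is a cover whose rectangles are pairwise disjoint. A cover (or partition) $C$ is $(i,j)$-local if each row of $Y$ is used by at most $i$ rectangles of $C$ and each column of $Y$ is used by at most $j$ rectangles of $C$. *)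

theory Defs
  imports Complex_Main "HOL-Library.Disjoint_Sets"
begin

definition young_diagram :: "nat \<Rightarrow> nat \<Rightarrow> (nat \<times> nat) set \<Rightarrow> bool" where
  "young_diagram r c Y \<longleftrightarrow>
     Y \<subseteq> {1..r} \<times> {1..c} \<and>
     (\<forall>(s, t) \<in> Y. (2 \<le> s \<longrightarrow> (s - 1, t) \<in> Y) \<and> (2 \<le> t \<longrightarrow> (s, t - 1) \<in> Y))"

definition steps :: "(nat \<times> nat) set \<Rightarrow> (nat \<times> nat) set" where
  "steps Y = {(s, t) \<in> Y. (s + 1, t) \<notin> Y \<and> (s, t + 1) \<notin> Y}"

definition generalized_rectangle ::
    "nat \<Rightarrow> nat \<Rightarrow> (nat \<times> nat) set \<Rightarrow> (nat \<times> nat) set \<Rightarrow> bool" where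
  "generalized_rectangle r c Y R \<longleftrightarrow>
     (\<exists>S T. S \<subseteq> {1..r} \<and> T \<subseteq> {1..c} \<and> R = S \<times> T \<and> R \<subseteq> Y)"

definition consecutive :: "nat set \<Rightarrow> bool" where
  "consecutive S \<longleftrightarrow> (\<exists>a b. S = {a..b})"

definition actual_rectangle ::
    "nat \<Rightarrow> nat \<Rightarrow> (nat \<times> nat) set \<Rightarrow> (nat \<times> nat) set \<Rightarrow> bool" where
  "actual_rectangle r c Y R \<longleftrightarrow>
     (\<exists>S T. S \<subseteq> {1..r} \<and> T \<subseteq> {1..c} \<and> R = S \<times> T \<and> R \<subseteq> Y \<and>
            consecutive S \<and> consecutive T)"

definition rect_cover ::
    "nat \<Rightarrow> nat \<Rightarrow> (nat \<times> nat) set \<Rightarrow> (nat \<times> nat) set set \<Rightarrow> bool" where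
  "rect_cover r c Y C \<longleftrightarrow> (\<forall>R\<in>C. generalized_rectangle r c Y R) \<and> Y = \<Union>C"

definition rect_partition ::
    "nat \<Rightarrow> nat \<Rightarrow> (nat \<times> nat) set \<Rightarrow> (nat \<times> nat) set set \<Rightarrow> bool" where
  "rect_partition r c Y C \<longleftrightarrow> rect_cover r c Y C \<and> disjoint C"

text \<open>
  A rectangle \<open>R = S \<times> T\<close> is represented by its set of cells. If it is nonempty then
  \<open>Domain R = S\<close> and \<open>Range R = T\<close>, so these are the rows and columns it uses; the empty
  rectangle, whose sides are not determined by its cells, uses none. The cardinalities below
  are of finite sets whenever the members of \<open>C\<close> are rectangles in a Young diagram, which is
  finite.
\<close>

definition ij_local ::
    "nat \<Rightarrow> nat \<Rightarrow> nat \<Rightarrow> nat \<Rightarrow> (nat \<times> nat) set set \<Rightarrow> bool" where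
  "ij_local i j r c C \<longleftrightarrow>
     (\<forall>s\<in>{1..r}. card {R \<in> C. s \<in> Domain R} \<le> i) \<and>
     (\<forall>t\<in>{1..c}. card {R \<in> C. t \<in> Range R} \<le> j)"

end

theory Submission
  imports Defs
begin

text \<open>
  Existence: rank the steps by column and pick one, \<open>(s, t)\<close>, in a suitable position. Use the full
  rectangle with corner \<open>(s, t)\<close> and recurse with parameters \<open>(i - 1, j)\<close> on the part of \<open>Y\<close> to its
  right and \<open>(i, j - 1)\<close> on the part below it; the step counts obey Pascal's rule.

  Non-existence: label each rectangle of a cover by its largest row. Then the rectangles using
  the row \<open>s\<close> of a step have labels at least \<open>s\<close>, those using the column of that step have labels
  at most \<open>s\<close>, and the covering property says that the labels of the row of a step meet the labels
  of the column of that step and of every step further down. Such a system of sets can be cut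
  into two smaller ones, again in accordance with Pascal's rule.
\<close>

section \<open>Choosing an element by its rank\<close>

text \<open>The least element with fewer than \<open>m\<close> elements above it works: its
  predecessor \<open>p\<close> has at least \<open>m\<close> above it, which leaves fewer than
  \<open>n\<close> for the elements below.\<close>

lemma exists_element_at_rank:
  fixes T :: "'a::linorder set"
  assumes "finite T" "T \<noteq> {}" "card T < m + n" "0 < m" "0 < n"
  shows "\<exists>t\<in>T. card {u\<in>T. t < u} < m \<and> card {u\<in>T. u < t} < n"
proof -
  let ?G = "{t\<in>T. card {u\<in>T. t < u} < m}"
  have "{u\<in>T. Max T < u} = {}"
    using assms(1) by (auto simp: not_less)
  then have "Max T \<in> ?G"
    using assms by (simp only: mem_Collect_eq card.empty Max_in simp_thms)
  then have G: "finite ?G" "?G \<noteq> {}"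
    using assms(1) by auto
  define t where "t = Min ?G"
  have t: "t \<in> ?G"
    unfolding t_def using G by (rule Min_in)
  have "card {u\<in>T. u < t} < n"
  proof (cases "{u\<in>T. u < t} = {}")
    case True
    then show ?thesis using assms(5) by (simp only: card.empty)
  next
    case False
    define p where "p = Max {u\<in>T. u < t}"
    have p: "p \<in> {u\<in>T. u < t}"
      unfolding p_def using assms(1) False by (intro Max_in) auto
    have "p \<notin> ?G"
      using p G(1) Min_le[of ?G p] unfolding t_def[symmetric] by auto
    then have "m \<le> card {u\<in>T. p < u}"
      using p by auto
    moreover have "u \<le> p" if "u \<in> T" "u < t" for u
      unfolding p_def using assms(1) that by (intro Max_ge) auto
    then have "{u\<in>T. u < t} \<inter> {u\<in>T. p < u} = {}"
      by fastforce
    then have "card {u\<in>T. u < t} + card {u\<in>T. p < u} \<le> card T"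
      using assms(1) by (subst card_Un_disjoint[symmetric]) (auto intro!: card_mono)
    ultimately show ?thesis using assms(3) by linarith
  qed
  with t show ?thesis by auto
qed

text \<open>Pascal's rule with the upper indices kept as sums, so that the summands are literally
  the bounds for the two recursive calls.\<close>

lemma Suc_Suc_choose:
  "(Suc i + Suc j) choose Suc i = ((i + Suc j) choose i) + ((Suc i + j) choose Suc i)"
  by simp

section \<open>Young diagrams with a shifted origin\<close>

text \<open>A Young diagram whose origin is moved to \<open>(a, b)\<close>. Cutting at a step leaves
  two pieces of this form, so the recursion needs no translation of coordinates.\<close>

definition staircase :: "nat \<Rightarrow> nat \<Rightarrow> (nat \<times> nat) set \<Rightarrow> bool" where
  "staircase a b Y \<longleftrightarrow> finite Y \<and>
     (\<forall>s t. (s, t) \<in> Y \<longrightarrow> a < s \<and> b < t \<and> {a<..s} \<times> {b<..t} \<subseteq> Y)"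

lemma staircaseI:
  assumes "finite Y" "\<And>s t. (s, t) \<in> Y \<Longrightarrow> a < s \<and> b < t"
    and down: "\<And>s t s' t'. (s, t) \<in> Y \<Longrightarrow> a < s' \<Longrightarrow> s' \<le> s \<Longrightarrow> b < t' \<Longrightarrow> t' \<le> t \<Longrightarrow> (s', t') \<in> Y"
  shows "staircase a b Y"
proof -
  have "{a<..s} \<times> {b<..t} \<subseteq> Y" if "(s, t) \<in> Y" for s t
    by (rule subrelI, rule down[OF that]) auto
  with assms(1,2) show ?thesis
    unfolding staircase_def by blast
qed

lemma staircaseD:
  assumes "staircase a b Y" "(s, t) \<in> Y"
  shows "a < s" "b < t" "\<And>s' t'. a < s' \<Longrightarrow> s' \<le> s \<Longrightarrow> b < t' \<Longrightarrow> t' \<le> t \<Longrightarrow> (s', t') \<in> Y"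
proof -
  have st: "a < s" "b < t" "{a<..s} \<times> {b<..t} \<subseteq> Y"
    using assms unfolding staircase_def by simp_all
  show "a < s" "b < t"
    by fact+
  show "(s', t') \<in> Y" if "a < s'" "s' \<le> s" "b < t'" "t' \<le> t" for s' t'
    using that by (intro subsetD[OF st(3)]) simp
qed

text \<open>The definition of a Young diagram only moves back by one row or column; downward
  induction iterates this, and the two directions are then composed.\<close>

lemma young_diagram_staircase:
  assumes "young_diagram r c Y"
  shows "staircase 0 0 Y"
proof -
  have sub: "Y \<subseteq> {1..r} \<times> {1..c}"
    using assms unfolding young_diagram_def by blast
  have up: "(s', t) \<in> Y" if "(s, t) \<in> Y" "0 < s'" "s' \<le> s" for s s' t
    using that(3,1,2)
  proof (induction rule: inc_induct)
    case (step n)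
    then have "(Suc n, t) \<in> Y" "2 \<le> Suc n" by auto
    then have "(Suc n - 1, t) \<in> Y" using assms unfolding young_diagram_def by blast
    then show ?case by simp
  qed
  have left: "(s, t') \<in> Y" if "(s, t) \<in> Y" "0 < t'" "t' \<le> t" for s t t'
    using that(3,1,2)
  proof (induction rule: inc_induct)
    case (step n)
    then have "(s, Suc n) \<in> Y" "2 \<le> Suc n" by auto
    then have "(s, Suc n - 1) \<in> Y" using assms unfolding young_diagram_def by blast
    then show ?case by simp
  qed
  show ?thesis
  proof (rule staircaseI)
    show "finite Y"
      using sub by (rule finite_subset) auto
    show "0 < s \<and> 0 < t" if "(s, t) \<in> Y" for s t
      using subsetD[OF sub that] by simp
  qed (rule left[OF up])
qed

section \<open>Steps, and the cut at a step\<close>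

lemma steps_subset: "steps Y \<subseteq> Y"
  unfolding steps_def by auto

text \<open>If \<open>s < s'\<close>, closure would put \<open>(Suc s, t)\<close> into
  \<open>Y\<close>; if \<open>t < t'\<close>, it would put \<open>(s, Suc t)\<close> there.\<close>

lemma step_maximal:
  assumes "staircase a b Y" "(s, t) \<in> steps Y" "(s', t') \<in> Y" "s \<le> s'" "t \<le> t'"
  shows "s' = s \<and> t' = t"
proof -
  have st: "(s, t) \<in> Y" "(Suc s, t) \<notin> Y" "(s, Suc t) \<notin> Y"
    using assms(2) unfolding steps_def by auto
  note 1 = staircaseD[OF assms(1) st(1)] and 2 = staircaseD[OF assms(1) assms(3)]
  have "\<not> s < s'"
    using 1(1,2) 2(3)[of "Suc s" t] st assms(5) by auto
  moreover have "\<not> t < t'"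
    using 1(1,2) 2(3)[of s "Suc t"] st assms(4) by auto
  ultimately show ?thesis
    using assms(4,5) by auto
qed

text \<open>By maximality the steps form an antichain in the componentwise order.\<close>

lemma steps_less_iff:
  assumes "staircase a b Y" "(s, t) \<in> steps Y" "(s', t') \<in> steps Y"
  shows "s < s' \<longleftrightarrow> t' < t"
proof -
  have Y: "(s, t) \<in> Y" "(s', t') \<in> Y"
    using assms(2,3) by (auto dest: subsetD[OF steps_subset])
  show ?thesis
  proof
    assume "s < s'"
    then show "t' < t"
      using step_maximal[OF assms(1,2) Y(2)] by (cases "t' < t") auto
  next
    assume "t' < t"
    then show "s < s'"
      using step_maximal[OF assms(1,3) Y(1)] by (cases "s < s'") auto
  qed
qed

text \<open>This allows counting steps by column in the construction and by row in the lower
  bound.\<close>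

lemma steps_inj:
  assumes "staircase a b Y"
  shows "inj_on fst (steps Y)" "inj_on snd (steps Y)"
proof -
  have eq_iff: "fst p = fst q \<longleftrightarrow> snd p = snd q" if "p \<in> steps Y" "q \<in> steps Y" for p q
  proof -
    have "fst p < fst q \<longleftrightarrow> snd q < snd p" "fst q < fst p \<longleftrightarrow> snd p < snd q"
      using that by (simp_all add: steps_less_iff[OF assms])
    then show ?thesis by (metis nat_neq_iff)
  qed
  show "inj_on fst (steps Y)" "inj_on snd (steps Y)"
    by (rule inj_onI, metis eq_iff prod_eqI)+
qed

text \<open>A cell with the largest coordinate sum is a step.\<close>

lemma steps_nonempty:
  assumes "finite Y" "Y \<noteq> {}"
  shows "steps Y \<noteq> {}"
proof -
  obtain p where p: "p \<in> Y" "\<And>q. q \<in> Y \<Longrightarrow> fst q + snd q \<le> fst p + snd p"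
    using Max_in[of "(\<lambda>q. fst q + snd q) ` Y"] Max_ge[of "(\<lambda>q. fst q + snd q) ` Y"] assms
    by fastforce
  have "(Suc (fst p), snd p) \<notin> Y" "(fst p, Suc (snd p)) \<notin> Y"
    using p(2)[of "(Suc (fst p), snd p)"] p(2)[of "(fst p, Suc (snd p))"] by auto
  with p(1) show ?thesis
    unfolding steps_def by (cases p) auto
qed

text \<open>Maximality of the step puts everything beyond column \<open>t\<close> strictly above row
  \<open>s\<close>, and everything beyond row \<open>s\<close> strictly left of column
  \<open>t\<close>. So the corner rectangle shares rows only with \<open>right\<close> and columns
  only with \<open>below\<close>, and these two pieces share neither.\<close>

lemma staircase_corner_decomposition:
  fixes Y :: "(nat \<times> nat) set"
  assumes "staircase a b Y" "(s, t) \<in> steps Y"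
  defines "right \<equiv> {(x, y) \<in> Y. t < y}" and "below \<equiv> {(x, y) \<in> Y. s < x}"
  shows "staircase a t right" "staircase s b below"
    and "right \<subseteq> {..<s} \<times> {t<..}" "below \<subseteq> {s<..} \<times> {..<t}"
    and "Y = {Suc a..s} \<times> {Suc b..t} \<union> right \<union> below"
    and "steps right = {p \<in> steps Y. t < snd p}" "steps below = {p \<in> steps Y. s < fst p}"
proof -
  have st: "(s, t) \<in> Y"
    using assms(2) by (rule subsetD[OF steps_subset])
  note st_max = step_maximal[OF assms(1,2)]
  have "finite Y"
    using assms(1) unfolding staircase_def by blast
  then have fin: "finite right" "finite below"
    unfolding right_def below_def by (auto elim: rev_finite_subset)
  show "staircase a t right"
  proof (rule staircaseI)
    fix x y assume xy: "(x, y) \<in> right"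
    then have Y: "(x, y) \<in> Y"
      unfolding right_def by simp
    show "a < x \<and> t < y"
      using xy staircaseD(1)[OF assms(1) Y] unfolding right_def by simp
    show "(x', y') \<in> right" if "a < x'" "x' \<le> x" "t < y'" "y' \<le> y" for x' y'
      using that staircaseD(2)[OF assms(1) st] staircaseD(3)[OF assms(1) Y, of x' y']
      unfolding right_def by simp
  qed (fact fin)
  show "staircase s b below"
  proof (rule staircaseI)
    fix x y assume xy: "(x, y) \<in> below"
    then have Y: "(x, y) \<in> Y"
      unfolding below_def by simp
    show "s < x \<and> b < y"
      using xy staircaseD(2)[OF assms(1) Y] unfolding below_def by simp
    show "(x', y') \<in> below" if "s < x'" "x' \<le> x" "b < y'" "y' \<le> y" for x' y'
      using that staircaseD(1)[OF assms(1) st] staircaseD(3)[OF assms(1) Y, of x' y']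
      unfolding below_def by simp
  qed (fact fin)
  show "right \<subseteq> {..<s} \<times> {t<..}"
  proof (rule subrelI)
    fix x y assume "(x, y) \<in> right"
    then show "(x, y) \<in> {..<s} \<times> {t<..}"
      using st_max[of x y] unfolding right_def by (cases "x < s") auto
  qed
  show "below \<subseteq> {s<..} \<times> {..<t}"
  proof (rule subrelI)
    fix x y assume "(x, y) \<in> below"
    then show "(x, y) \<in> {s<..} \<times> {..<t}"
      using st_max[of x y] unfolding below_def by (cases "y < t") auto
  qed
  have mem: "(x, y) \<in> right \<longleftrightarrow> (x, y) \<in> Y \<and> t < y" "(x, y) \<in> below \<longleftrightarrow> (x, y) \<in> Y \<and> s < x" for x y
    unfolding right_def below_def by simp_all
  show "Y = {Suc a..s} \<times> {Suc b..t} \<union> right \<union> below"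
  proof (intro subset_antisym subrelI)
    fix x y assume "(x, y) \<in> Y"
    then show "(x, y) \<in> {Suc a..s} \<times> {Suc b..t} \<union> right \<union> below"
      using staircaseD(1,2)[OF assms(1), of x y] by (cases "s < x"; cases "t < y") (simp_all add: mem)
  next
    fix x y assume "(x, y) \<in> {Suc a..s} \<times> {Suc b..t} \<union> right \<union> below"
    then show "(x, y) \<in> Y"
      using staircaseD(3)[OF assms(1) st, of x y] by (auto simp: mem)
  qed
  \<comment> \<open>The lower and right neighbours of a cell beyond column \<open>t\<close> are
    again beyond it, so being a step does not change.\<close>
  show "steps right = {p \<in> steps Y. t < snd p}"
    by (rule set_eqI, rename_tac p, case_tac p) (auto simp: steps_def mem)
  show "steps below = {p \<in> steps Y. s < fst p}"
    by (rule set_eqI, rename_tac p, case_tac p) (auto simp: steps_def mem)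
qed

section \<open>Construction of the local partition\<close>

text \<open>Each recursive call lowers one parameter, and the corner rectangle uses up what was
  given away: one rectangle in the rows of the right part, one in the columns of the lower
  part.\<close>

lemma staircase_local_partition:
  assumes "staircase a b Y" "card (steps Y) < (i + j) choose i"
  shows "\<exists>C. \<Union>C = Y \<and> disjoint C \<and> (\<forall>R\<in>C. \<exists>p q u v. R = {p..q} \<times> {u..v}) \<and>
    (\<forall>s. card {R\<in>C. s \<in> Domain R} \<le> i) \<and> (\<forall>t. card {R\<in>C. t \<in> Range R} \<le> j)"
  using assms
proof (induction "i + j" arbitrary: i j a b Y rule: less_induct)
  case less
  have fin: "finite Y"
    using less.prems(1) unfolding staircase_def by blast
  have fin_steps: "finite (steps Y)"
    using fin steps_subset by (rule rev_finite_subset)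
  show ?case
  proof (cases "Y = {}")
    case True
    then show ?thesis by (intro exI[of _ "{}"]) auto
  next
    case False
    then have ne: "steps Y \<noteq> {}"
      using steps_nonempty[OF fin] by simp
    \<comment> \<open>A step exists, so the binomial coefficient exceeds 1. This rules out
      \<open>i = 0\<close> and \<open>j = 0\<close>; the empty diagram is the only base
      case.\<close>
    then have "1 < (i + j) choose i"
      using less.prems(2) fin_steps by (metis card_gt_0_iff less_one nat_neq_iff not_less_zero order_less_trans)
    then obtain i' j' where ij: "i = Suc i'" "j = Suc j'"
      by (cases i; cases j) auto
    have "card (snd ` steps Y) < ((i' + j) choose i') + ((i + j') choose i)"
      using less.prems(2) Suc_Suc_choose[of i' j'] unfolding ij
      by (simp only: card_image[OF steps_inj(2)[OF less.prems(1)]])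
    then obtain t where "t \<in> snd ` steps Y"
      and t: "card {u \<in> snd ` steps Y. t < u} < (i' + j) choose i'"
        "card {u \<in> snd ` steps Y. u < t} < (i + j') choose i"
      using exists_element_at_rank[of "snd ` steps Y" "(i' + j) choose i'" "(i + j') choose i"]
        fin_steps ne by (auto simp: zero_less_binomial_iff)
    then obtain s where st: "(s, t) \<in> steps Y"
      by auto
    define Y1 where "Y1 = {(x, y) \<in> Y. t < y}"
    define Y2 where "Y2 = {(x, y) \<in> Y. s < x}"
    define R0 where "R0 = {Suc a..s} \<times> {Suc b..t}"
    note dec = staircase_corner_decomposition[OF less.prems(1) st,
        folded Y1_def Y2_def, folded R0_def]
    have "card (steps Y1) = card (snd ` {p \<in> steps Y. t < snd p})"
      unfolding dec(6) using steps_inj(2)[OF less.prems(1)]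
      by (intro card_image[symmetric]) (auto intro: inj_on_subset)
    also have "snd ` {p \<in> steps Y. t < snd p} = {u \<in> snd ` steps Y. t < u}"
      by auto
    finally have "card (steps Y1) < (i' + j) choose i'"
      using t(1) by simp
    then obtain C1 where C1: "\<Union>C1 = Y1" "disjoint C1"
      "\<forall>R\<in>C1. \<exists>p q u v. R = {p..q} \<times> {u..v}"
      "\<And>s. card {R\<in>C1. s \<in> Domain R} \<le> i'" "\<And>t. card {R\<in>C1. t \<in> Range R} \<le> j"
      using less.hyps[of i' j a t Y1] dec(1) ij by auto
    \<comment> \<open>The steps below row \<open>s\<close> are those left of column
      \<open>t\<close>, so the rank by column also counts the steps of \<open>Y2\<close>.\<close>
    have "{p \<in> steps Y. s < fst p} = {p \<in> steps Y. snd p < t}"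
      using steps_less_iff[OF less.prems(1) st] by auto
    then have "card (steps Y2) = card (snd ` {p \<in> steps Y. snd p < t})"
      unfolding dec(7) using steps_inj(2)[OF less.prems(1)]
      by (simp, intro card_image[symmetric]) (auto intro: inj_on_subset)
    also have "snd ` {p \<in> steps Y. snd p < t} = {u \<in> snd ` steps Y. u < t}"
      by auto
    finally have "card (steps Y2) < (i + j') choose i"
      using t(2) by simp
    then obtain C2 where C2: "\<Union>C2 = Y2" "disjoint C2"
      "\<forall>R\<in>C2. \<exists>p q u v. R = {p..q} \<times> {u..v}"
      "\<And>s. card {R\<in>C2. s \<in> Domain R} \<le> i" "\<And>t. card {R\<in>C2. t \<in> Range R} \<le> j'"
      using less.hyps[of i j' s b Y2] dec(2) ij by auto
    have fin12: "finite C1" "finite C2"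
      using C1(1) C2(1) dec(5) fin by (auto intro!: finite_UnionD)
    have C1_bounds: "Domain R \<subseteq> {..<s}" "Range R \<subseteq> {t<..}" if "R \<in> C1" for R
      using that C1(1) dec(3) by blast+
    have C2_bounds: "Domain R \<subseteq> {s<..}" "Range R \<subseteq> {..<t}" if "R \<in> C2" for R
      using that C2(1) dec(4) by blast+
    have R0_bounds: "Domain R0 \<subseteq> {..s}" "Range R0 \<subseteq> {..t}"
      unfolding R0_def by auto
    let ?C = "insert R0 (C1 \<union> C2)"
    have "\<Union>?C = Y"
      using C1(1) C2(1) dec(5) by auto
    moreover have "disjoint ?C"
    proof -
      have "Y1 \<inter> Y2 = {}"
        using dec(3,4) by fastforce
      then have "disjoint (C1 \<union> C2)"
        using C1(1) C2(1) by (intro disjoint_union[OF C1(2) C2(2)]) simp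
      moreover have "R0 \<inter> (Y1 \<union> Y2) = {}"
        using dec(3,4) unfolding R0_def by fastforce
      ultimately have "disjoint ({R0} \<union> (C1 \<union> C2))"
        using C1(1) C2(1) by (intro disjoint_union[of "{R0}"]) (simp_all add: Int_Un_distrib)
      then show ?thesis by simp
    qed
    moreover have "\<forall>R\<in>?C. \<exists>p q u v. R = {p..q} \<times> {u..v}"
      using C1(3) C2(3) unfolding R0_def by blast
    \<comment> \<open>Rows below \<open>s\<close> meet only \<open>C2\<close>; the others meet at
      most \<open>R0\<close> and members of \<open>C1\<close>, hence at most \<open>Suc i'\<close>
      rectangles. Columns are treated symmetrically.\<close>
    moreover have "card {R\<in>?C. x \<in> Domain R} \<le> i" for x
    proof (cases "s < x")
      case True
      then have "{R\<in>?C. x \<in> Domain R} \<subseteq> {R\<in>C2. x \<in> Domain R}"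
        using C1_bounds(1) R0_bounds(1) by fastforce
      then have "card {R\<in>?C. x \<in> Domain R} \<le> card {R\<in>C2. x \<in> Domain R}"
        using fin12 by (intro card_mono) auto
      then show ?thesis
        using C2(4)[of x] by linarith
    next
      case False
      then have "{R\<in>?C. x \<in> Domain R} \<subseteq> insert R0 {R\<in>C1. x \<in> Domain R}"
        using C2_bounds(1) by fastforce
      then have "card {R\<in>?C. x \<in> Domain R} \<le> card (insert R0 {R\<in>C1. x \<in> Domain R})"
        using fin12 by (intro card_mono) auto
      also have "\<dots> \<le> Suc (card {R\<in>C1. x \<in> Domain R})"
        by (rule card_insert_le_m1) auto
      finally show ?thesis
        using C1(4)[of x] ij by linarith
    qed
    moreover have "card {R\<in>?C. y \<in> Range R} \<le> j" for y
    proof (cases "t < y")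
      case True
      then have "{R\<in>?C. y \<in> Range R} \<subseteq> {R\<in>C1. y \<in> Range R}"
        using C2_bounds(2) R0_bounds(2) by fastforce
      then have "card {R\<in>?C. y \<in> Range R} \<le> card {R\<in>C1. y \<in> Range R}"
        using fin12 by (intro card_mono) auto
      then show ?thesis
        using C1(5)[of y] by linarith
    next
      case False
      then have "{R\<in>?C. y \<in> Range R} \<subseteq> insert R0 {R\<in>C2. y \<in> Range R}"
        using C1_bounds(2) by fastforce
      then have "card {R\<in>?C. y \<in> Range R} \<le> card (insert R0 {R\<in>C2. y \<in> Range R})"
        using fin12 by (intro card_mono) auto
      also have "\<dots> \<le> Suc (card {R\<in>C2. y \<in> Range R})"
        by (rule card_insert_le_m1) auto
      finally show ?thesis
        using C2(5)[of y] ij by linarith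
    qed
    ultimately show ?thesis
      by (intro exI[of _ ?C]) blast
  qed
qed

section \<open>Skew-intersecting families of sets\<close>

text \<open>
  A skew set-pair inequality in the style of Bollobas. The cut point \<open>m\<close> is the largest element of \<open>K\<close>
  past which every earlier \<open>A k\<close> still reaches; its maximality forces every later \<open>B l\<close> to reach
  back, so both halves lose an element.
\<close>

lemma card_less_choose_if_skew_intersecting:
  fixes K :: "'a::linorder set" and A B :: "'a \<Rightarrow> 'a set"
  assumes "finite K"
    and "\<And>k. k \<in> K \<Longrightarrow> A k \<subseteq> {k..} \<and> finite (A k) \<and> card (A k) \<le> i"
    and "\<And>k. k \<in> K \<Longrightarrow> B k \<subseteq> {..k} \<and> finite (B k) \<and> card (B k) \<le> j"
    and "\<And>k l. k \<in> K \<Longrightarrow> l \<in> K \<Longrightarrow> k \<le> l \<Longrightarrow> A k \<inter> B l \<noteq> {}"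
  shows "card K < (i + j) choose i"
  using assms
proof (induction "i + j" arbitrary: i j K A B rule: less_induct)
  case less
  note fin = less.prems(1) and A = less.prems(2) and B = less.prems(3) and AB = less.prems(4)
  show ?case
  proof (cases "K = {}")
    case True
    then show ?thesis by (simp add: zero_less_binomial_iff)
  next
    case False
    then obtain k0 where k0: "k0 \<in> K" by blast
    \<comment> \<open>The case \<open>k = l\<close> of the intersection hypothesis shows that
      neither parameter is 0.\<close>
    have "A k0 \<noteq> {}" "B k0 \<noteq> {}"
      using AB[OF k0 k0] by auto
    then have "0 < card (A k0)" "0 < card (B k0)"
      using A[OF k0] B[OF k0] by (auto simp: card_gt_0_iff)
    then have "0 < i" "0 < j"
      using A[OF k0] B[OF k0] by linarith+
    then obtain i' j' where ij: "i = Suc i'" "j = Suc j'"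
      by (cases i; cases j) auto
    define L where "L = {m\<in>K. \<forall>k\<in>K. k < m \<longrightarrow> A k \<inter> {m..} \<noteq> {}}"
    \<comment> \<open>The condition is vacuous at the least element, so a cut point exists.\<close>
    have "Min K \<in> L"
      unfolding L_def using fin False by (auto dest: Min_le leD)
    then have L: "finite L" "L \<noteq> {}"
      using fin unfolding L_def by auto
    define m where "m = Max L"
    have m: "m \<in> L" "\<And>x. x \<in> L \<Longrightarrow> x \<le> m"
      unfolding m_def using L by auto
    define K1 where "K1 = {k\<in>K. k < m}"
    define K2 where "K2 = {k\<in>K. m < k}"
    have K_split: "K = insert m (K1 \<union> K2)"
      using m(1) unfolding L_def K1_def K2_def by auto
    have fin12: "finite K1" "finite K2"
      using fin unfolding K1_def K2_def by auto
    \<comment> \<open>Truncating \<open>A k\<close> at \<open>m\<close> removes an element, since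
      \<open>A k\<close> reaches \<open>{m..}\<close>. Intersections survive because
      \<open>B l\<close> lies below \<open>m\<close>.\<close>
    have card1: "card K1 < (i' + j) choose i'"
    proof (rule less.hyps[of i' j K1 "\<lambda>k. A k \<inter> {..<m}" B])
      fix k assume k: "k \<in> K1"
      then have "A k \<inter> {m..} \<noteq> {}"
        using m(1) unfolding L_def K1_def by blast
      then obtain x where "x \<in> A k" "x \<notin> A k \<inter> {..<m}"
        by force
      then have "A k \<inter> {..<m} \<subset> A k"
        by blast
      then have "card (A k \<inter> {..<m}) < card (A k)"
        using A k unfolding K1_def by (intro psubset_card_mono) auto
      then show "A k \<inter> {..<m} \<subseteq> {k..} \<and> finite (A k \<inter> {..<m}) \<and> card (A k \<inter> {..<m}) \<le> i'"
        using A[of k] k ij unfolding K1_def by auto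
    next
      fix k l assume kl: "k \<in> K1" "l \<in> K1" "k \<le> l"
      then obtain x where "x \<in> A k" "x \<in> B l"
        using AB[of k l] unfolding K1_def by auto
      moreover have "x < m"
        using B[of l] kl \<open>x \<in> B l\<close> unfolding K1_def by force
      ultimately show "A k \<inter> {..<m} \<inter> B l \<noteq> {}" by auto
    qed (use fin12 B ij K1_def in auto)
    have card2: "card K2 < (i + j') choose i"
    proof (cases "K2 = {}")
      case True
      then show ?thesis by (simp add: zero_less_binomial_iff)
    next
      case False
      define m' where "m' = Min K2"
      have m': "m' \<in> K2" "\<And>x. x \<in> K2 \<Longrightarrow> m' \<le> x"
        unfolding m'_def using fin12 False by auto
      \<comment> \<open>By maximality of \<open>m\<close>, some \<open>A k1\<close> with
        \<open>k1 < m'\<close> stays below \<open>m'\<close>. Each \<open>B l\<close> with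
        \<open>l\<close> in \<open>K2\<close> meets it and thus loses an element when restricted to
        \<open>{m'..}\<close>; intersections survive because \<open>A k\<close> lies in
        \<open>{m'..}\<close>.\<close>
      have "m' \<notin> L"
        using m(2)[of m'] m'(1) unfolding K2_def by auto
      then obtain k1 where k1: "k1 \<in> K" "k1 < m'" "A k1 \<inter> {m'..} = {}"
        using m'(1) unfolding L_def K2_def by auto
      show ?thesis
      proof (rule less.hyps[of i j' K2 A "\<lambda>l. B l \<inter> {m'..}"])
        fix l assume l: "l \<in> K2"
        then have "k1 \<le> l"
          using k1(2) m'(2)[of l] by auto
        then obtain x where "x \<in> A k1" "x \<in> B l"
          using AB[of k1 l] k1(1) l unfolding K2_def by auto
        then have "B l \<inter> {m'..} \<subset> B l"
          using k1(3) by blast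
        then have "card (B l \<inter> {m'..}) < card (B l)"
          using B l unfolding K2_def by (intro psubset_card_mono) auto
        then show "B l \<inter> {m'..} \<subseteq> {..l} \<and> finite (B l \<inter> {m'..}) \<and> card (B l \<inter> {m'..}) \<le> j'"
          using B[of l] l ij unfolding K2_def by auto
      next
        fix k l assume kl: "k \<in> K2" "l \<in> K2" "k \<le> l"
        then obtain x where "x \<in> A k" "x \<in> B l"
          using AB[of k l] unfolding K2_def by auto
        moreover have "m' \<le> x"
          using A[of k] kl m'(2)[of k] \<open>x \<in> A k\<close> unfolding K2_def by force
        ultimately show "A k \<inter> (B l \<inter> {m'..}) \<noteq> {}" by auto
      qed (use fin12 A ij K2_def in auto)
    qed
    \<comment> \<open>The 1 contributed by \<open>m\<close> is absorbed because the bounds for both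
      halves are strict.\<close>
    have "card K \<le> Suc (card K1 + card K2)"
      unfolding K_split
      by (rule card_insert_le_m1) (simp_all add: card_Un_le)
    then show ?thesis
      using card1 card2 Suc_Suc_choose[of i' j'] unfolding ij by linarith
  qed
qed

section \<open>From local covers to skew-intersecting families\<close>

text \<open>The set-pair inequality is applied with the rows of the steps as indices and labels of
  rectangles as elements. Distinct rectangles may share a label, which only makes the sets
  smaller.\<close>

lemma staircase_local_cover_card_steps:
  assumes "staircase a b Y" "\<Union>C = Y" "\<And>R. R \<in> C \<Longrightarrow> \<exists>S T. R = S \<times> T"
    and rows: "\<And>s t. (s, t) \<in> Y \<Longrightarrow> card {R\<in>C. s \<in> Domain R} \<le> i"
    and cols: "\<And>s t. (s, t) \<in> Y \<Longrightarrow> card {R\<in>C. t \<in> Range R} \<le> j"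
  shows "card (steps Y) < (i + j) choose i"
proof -
  have finY: "finite Y"
    using assms(1) unfolding staircase_def by blast
  have fin: "finite (steps Y)" "finite C" "\<And>R. R \<in> C \<Longrightarrow> finite R"
    using finite_subset[OF steps_subset finY] finite_UnionD[of C] rev_finite_subset[OF finY] assms(2)
    by auto
  have "\<forall>s \<in> fst ` steps Y. \<exists>t. (s, t) \<in> steps Y"
    by force
  then obtain col where col: "\<And>s. s \<in> fst ` steps Y \<Longrightarrow> (s, col s) \<in> steps Y"
    by (metis bchoice)
  \<comment> \<open>\<open>Max\<close> is unspecified for the empty rectangle, but \<open>A\<close>
    and \<open>B\<close> collect only rectangles that use some row or column.\<close>
  define label :: "(nat \<times> nat) set \<Rightarrow> nat" where "label R = Max (Domain R)" for R
  define A where "A s = label ` {R\<in>C. s \<in> Domain R}" for s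
  define B where "B s = label ` {R\<in>C. col s \<in> Range R}" for s
  have "card (fst ` steps Y) < (i + j) choose i"
  proof (rule card_less_choose_if_skew_intersecting[of _ A i B j])
    fix s assume s: "s \<in> fst ` steps Y"
    note st = col[OF s]
    have stY: "(s, col s) \<in> Y"
      using st by (rule subsetD[OF steps_subset])
    have "A s \<subseteq> {s..}"
      using fin(3) unfolding A_def label_def by (auto simp: finite_Domain intro!: Max_ge)
    moreover have "card (A s) \<le> i"
      unfolding A_def using rows[OF stY] card_image_le[of "{R\<in>C. s \<in> Domain R}" label] fin(2)
      by simp
    ultimately show "A s \<subseteq> {s..} \<and> finite (A s) \<and> card (A s) \<le> i"
      using fin(2) unfolding A_def by auto
    have "B s \<subseteq> {..s}"
    proof
      fix x assume "x \<in> B s"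
      then obtain R where R: "R \<in> C" "col s \<in> Range R" "x = label R"
        unfolding B_def by auto
      \<comment> \<open>Since \<open>R\<close> is a product, its largest row meets column
        \<open>col s\<close> in a cell of \<open>Y\<close>, and a step is the last cell of its
        column.\<close>
      have "x \<in> Domain R"
        unfolding R(3) label_def using fin(3)[OF R(1)] R(2)
        by (intro Max_in) (auto simp: finite_Domain)
      then have "(x, col s) \<in> Y"
        using R(1,2) assms(2) assms(3)[OF R(1)] by auto
      then show "x \<in> {..s}"
        using step_maximal[OF assms(1) st, of x "col s"] by (cases "s \<le> x") auto
    qed
    moreover have "card (B s) \<le> j"
      unfolding B_def using cols[OF stY] card_image_le[of "{R\<in>C. col s \<in> Range R}" label] fin(2)
      by simp
    ultimately show "B s \<subseteq> {..s} \<and> finite (B s) \<and> card (B s) \<le> j"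
      using fin(2) unfolding B_def by auto
  next
    fix s s' assume s: "s \<in> fst ` steps Y" "s' \<in> fst ` steps Y" "s \<le> s'"
    have "(s, col s) \<in> Y" "(s', col s') \<in> Y"
      using s(1,2) by (auto intro: subsetD[OF steps_subset] col)
    \<comment> \<open>A rectangle covering this cell uses row \<open>s\<close> and column
      \<open>col s'\<close>, so its label is common to \<open>A s\<close> and
      \<open>B s'\<close>.\<close>
    then have "(s, col s') \<in> Y"
      using s(3) staircaseD[OF assms(1)] by blast
    then obtain R where "R \<in> C" "(s, col s') \<in> R"
      using assms(2) by auto
    then show "A s \<inter> B s' \<noteq> {}"
      unfolding A_def B_def by blast
  qed (use fin in auto)
  then show ?thesis
    by (simp add: card_image steps_inj(1)[OF assms(1)])
qed

theorem theorem3: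
  fixes i j z r c :: nat and Y :: "(nat \<times> nat) set"
  assumes "young_diagram r c Y"
    and "card (steps Y) = z"
  shows "(z < (i + j) choose i \<longrightarrow>
            (\<exists>C. rect_partition r c Y C \<and> (\<forall>R\<in>C. actual_rectangle r c Y R) \<and> ij_local i j r c C)) \<and>
         (z \<ge> (i + j) choose i \<longrightarrow>
            \<not> (\<exists>C. rect_cover r c Y C \<and> ij_local i j r c C))"
proof -
  note sc = young_diagram_staircase[OF assms(1)]
  have sub: "Y \<subseteq> {1..r} \<times> {1..c}"
    using assms(1) unfolding young_diagram_def by blast
  have "\<exists>C. rect_partition r c Y C \<and> (\<forall>R\<in>C. actual_rectangle r c Y R) \<and> ij_local i j r c C"
    if z: "z < (i + j) choose i"
  proof -
    obtain C where C: "\<Union>C = Y" "disjoint C" "\<forall>R\<in>C. \<exists>p q u v. R = {p..q} \<times> {u..v}"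
      "\<And>s. card {R\<in>C. s \<in> Domain R} \<le> i" "\<And>t. card {R\<in>C. t \<in> Range R} \<le> j"
      using staircase_local_partition[OF sc, of i j] z assms(2) by auto
    have act: "actual_rectangle r c Y R" if R: "R \<in> C" for R
    proof (cases "R = {}")
      case True
      \<comment> \<open>For an empty product one of the given sides may leave the grid, so both
        sides are replaced by the empty interval \<open>{1..0}\<close>.\<close>
      have "consecutive {}"
        unfolding consecutive_def by (intro exI[of _ 1] exI[of _ 0]) simp
      then show ?thesis
        unfolding True actual_rectangle_def by (intro exI[of _ "{}"]) simp
    next
      case False
      obtain p q u v where eq: "R = {p..q} \<times> {u..v}"
        using bspec[OF C(3) R] by (elim exE)
      have RY: "R \<subseteq> Y"
        unfolding C(1)[symmetric] using R by (rule Union_upper)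
      then have "{p..q} \<times> {u..v} \<subseteq> {1..r} \<times> {1..c}"
        using sub unfolding eq by (rule order_trans)
      then have "{p..q} \<subseteq> {1..r}" "{u..v} \<subseteq> {1..c}"
        using False unfolding eq times_subset_iff times_eq_iff by simp_all
      moreover have "consecutive {p..q}" "consecutive {u..v}"
        unfolding consecutive_def by (rule exI, rule exI, rule refl)+
      ultimately show ?thesis
        unfolding actual_rectangle_def using RY eq
        by (intro exI[of _ "{p..q}"] exI[of _ "{u..v}"] conjI)
    qed
    then have "\<forall>R\<in>C. generalized_rectangle r c Y R"
      unfolding actual_rectangle_def generalized_rectangle_def by blast
    then show ?thesis
      using C act unfolding rect_partition_def rect_cover_def ij_local_def
      by (intro exI[of _ C]) simp
  qed
  \<comment> \<open>The second claim is proved in contrapositive form: a local cover bounds the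
    number of steps.\<close>
  moreover have "z < (i + j) choose i" if C: "rect_cover r c Y C" "ij_local i j r c C" for C
    unfolding assms(2)[symmetric]
  proof (rule staircase_local_cover_card_steps[OF sc])
    show "\<Union>C = Y"
      using C(1) unfolding rect_cover_def by simp
    show "\<exists>S T. R = S \<times> T" if "R \<in> C" for R
    proof -
      have "generalized_rectangle r c Y R"
        using C(1) that unfolding rect_cover_def by (rule conjunct1[THEN bspec])
      then show ?thesis
        unfolding generalized_rectangle_def by (elim exE conjE) (rule exI, rule exI)
    qed
    show "card {R\<in>C. s \<in> Domain R} \<le> i" "card {R\<in>C. t \<in> Range R} \<le> j" if "(s, t) \<in> Y" for s t
      using C(2) subsetD[OF sub that] unfolding ij_local_def by simp_all
  qed
  ultimately show ?thesis
    by (meson not_less)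
qed

end
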